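(* Let $\mathcal{V} \subset \mathcal{H}$ be real Hilbert spaces with continuous embedding, and let $\mathcal{K} : \mathcal{V} \to \mathcal{V}^*$ and $\mathcal{M} : \mathcal{H} \to \mathcal{H}^*$ be operators satisfying the following assumptions. (A1) $\mathcal{K}$ (possibly nonlinear) is strongly monotone and Lipschitz: there exist constants $L, \gamma > 0$ such that for all $u, v \in \mathcal{V}$, $$\langle \mathcal{K}(u) - \mathcal{K}(v), u - v\rangle \ge \gamma \|u-v\|_{\mathcal{V}}^2 \quad\text{and}\quad \|\mathcal{K}(u) - \mathcal{K}(v)\|_{\mathcal{V}^*} \le L \|u-v\|_{\mathcal{V}}.$$ (A2) $\mathcal{M}$ is linear, continuous, symmetric and non-negative: there is a constant $C$ such that $\|\mathcal{M}u\|_{\mathcal{H}} \le C\|u\|_{\mathcal{H}}$, $\langle \mathcal{M}u, v\rangle = \langle u, \mathcal{M}v\rangle$ and $\langle \mathcal{M}u,u\rangle \ge 0$ for all $u,v \in \mathcal{H}$. Let $T>0$, $N \in \mathbb{N}$ with $N \ge 1$, $\tau = T/N$, and $(f^1,\ldots,f^N) \in (\mathcal{V}^* )^N$. Let $\widehat{\mathcal{K}} : \mathcal{V} \to \mathcal{V}^*$ be a linear, continuous, symmetric and elliptic operator which satisfies, for some $q < 1$, $$\|\widehat{\mathcal{K}}(u-v) - (\mathcal{K}(u) - \mathcal{K}(v))\|_{\widehat{\mathcal{K}}^{-1}} \le q\, \|u-v\|_{\widehat{\mathcal{K}}} \qquad \text{for all } u,v \in \mathcal{V}.$$ Then for any initial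 iterate $U^0 = (u^{1,0},\ldots,u^{N,0}) \in \mathcal{V}^N$, the iteration which, for $k \ge 0$, determines $U^{k+1} = (u^{1,k+1},\ldots,u^{N,k+1}) \in \mathcal{V}^N$ from $U^k = (u^{1,k},\ldots,u^{N,k})$ by $$\mathcal{M}\, d_\tau u^{n,k+1} + \widehat{\mathcal{K}} u^{n,k+1} = f^n + \widehat{\mathcal{K}} u^{n,k} - \mathcal{K}(u^{n,k}) \quad\text{in } \mathcal{V}^*, \quad n = 1,\ldots,N, \qquad \text{with } u^{0,k+1} = u^{N,k+1},$$ converges linearly to the unique solution $U = (u^1,\ldots,u^N) \in \mathcal{V}^N$ of $$\mathcal{M}\, d_\tau u^n + \mathcal{K}(u^n) = f^n \quad \text{in } \mathcal{V}^*, \quad n = 1,\ldots,N, \qquad \text{with } u^0 = u^N,$$ i.e., $$\|U^{k+1} - U\|_{\widehat{\mathcal{K}}} \le q\, \|U^k - U\|_{\widehat{\mathcal{K}}} \qquad \text{for all } k \ge 0.$$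
   Context: The space $\mathcal{H}$ is identified with its dual $\mathcal{H}^*$, giving the Gelfand triple $\mathcal{V} \subset \mathcal{H} \subset \mathcal{V}^*$; $\langle\cdot,\cdot\rangle$ denotes the duality pairing, and elements of $\mathcal{H}^*$ (in particular $\mathcal{M}w$ for $w\in\mathcal{V}$) are regarded as elements of $\mathcal{V}^*$ by restriction to $\mathcal{V}$. The symbol $d_\tau u^n = \frac{1}{\tau}(u^n - u^{n-1})$ denotes the backward difference quotient (acting on the index $n$, so $d_\tau u^{n,k} = \frac1\tau(u^{n,k}-u^{n-1,k})$); the condition $u^0 = u^N$ serves to define $d_\tau u^1 = \frac{1}{\tau}(u^1 - u^N)$, and likewise for the iterates. Symmetric means $\langle \widehat{\mathcal{K}}u, v\rangle = \langle \widehat{\mathcal{K}} v, u\rangle$ for all $u,v\in\mathcal{V}$; elliptic means that there is $\alpha > 0$ with $\langle \widehat{\mathcal{K}} u,u\rangle \ge \alpha\|u\|_{\mathcal{V}}^2$ for all $u \in \mathcal{V}$. The norms induced by $\widehat{\mathcal{K}}$ are $\|u\|_{\widehat{\mathcal{K}}}^2 = \langle \widehat{\mathcal{K}}u,u\rangle$ on $\mathcal{V}$, $\|U\|_{\widehat{\mathcal{K}}}^2 = \sum_{n=1}^N \|u^n\|_{\widehat{\mathcal{K}}}^2$ on $\mathcal{V}^N$, and $\|f\|_{\widehat{\mathcal{K}}^{-1}}^2 = \langle \widehat{\mathcal{K}}^{-1} f, f\rangle$ on $\mathcal{V}^*$ (the pairing of $\widehat{\mathcal{K}}^{-1}f\in\mathcal{V}$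 with $f\in\mathcal{V}^*$). *)

theory Defs
  imports "HOL-Analysis.Analysis"
begin

text \<open>
  The topological dual of a normed space carries the operator norm, and the duality pairing
  of \<open>f\<close> and \<open>v\<close> is the application \<open>blinfun_apply f v\<close>.
\<close>

type_synonym 'a dual = "'a \<Rightarrow>\<^sub>L real"

definition symmetric_op :: "('a::real_normed_vector \<Rightarrow> 'a dual) \<Rightarrow> bool" where
  "symmetric_op A \<longleftrightarrow> (\<forall>u v. blinfun_apply (A u) v = blinfun_apply (A v) u)"

definition elliptic_op :: "('a::real_normed_vector \<Rightarrow> 'a dual) \<Rightarrow> bool" where
  "elliptic_op A \<longleftrightarrow> (\<exists>\<alpha>>0. \<forall>u. blinfun_apply (A u) u \<ge> \<alpha> * (norm u)\<^sup>2)"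

definition op_norm :: "('a::real_normed_vector \<Rightarrow> 'a dual) \<Rightarrow> 'a \<Rightarrow> real" where
  "op_norm A u = sqrt (blinfun_apply (A u) u)"

text \<open>
  \<open>inv A\<close> is a genuine two-sided inverse when \<open>A\<close> is linear, continuous and elliptic on a
  Hilbert space (Lax--Milgram).
\<close>

definition op_dual_norm :: "('a::real_normed_vector \<Rightarrow> 'a dual) \<Rightarrow> 'a dual \<Rightarrow> real" where
  "op_dual_norm A f = sqrt (blinfun_apply f (inv A f))"

text \<open>
  An \<open>N\<close>-tuple is a function on the indices \<open>1, \<dots>, N\<close> that is \<open>undefined\<close> elsewhere, so that
  tuples are equal iff their components are.
\<close>

definition tuples :: "nat \<Rightarrow> (nat \<Rightarrow> 'a) set" where
  "tuples N = {1..N} \<rightarrow>\<^sub>E UNIV"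

definition tuple_op_norm ::
    "nat \<Rightarrow> ('a::real_normed_vector \<Rightarrow> 'a dual) \<Rightarrow> (nat \<Rightarrow> 'a) \<Rightarrow> real" where
  "tuple_op_norm N A U = sqrt (\<Sum>n=1..N. (op_norm A (U n))\<^sup>2)"

text \<open>The periodicity condition replaces the missing component with index \<open>0\<close> by the one with index \<open>N\<close>.\<close>

definition periodic_diff :: "nat \<Rightarrow> real \<Rightarrow> (nat \<Rightarrow> 'a::real_vector) \<Rightarrow> nat \<Rightarrow> 'a" where
  "periodic_diff N \<tau> U n = (1 / \<tau>) *\<^sub>R (U n - (if n = 1 then U N else U (n - 1)))"

text \<open>
  \<open>J\<close> is the embedding of \<open>'v\<close> into \<open>'h\<close>; composing with \<open>J\<close> restricts a functional on \<open>'h\<close>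
  to \<open>'v\<close>.
\<close>

definition restricted_op ::
    "('v::real_normed_vector \<Rightarrow>\<^sub>L 'h::real_normed_vector) \<Rightarrow> ('h \<Rightarrow> 'h dual) \<Rightarrow> 'v \<Rightarrow> 'v dual" where
  "restricted_op J M w = M (blinfun_apply J w) o\<^sub>L J"

definition periodic_solution ::
    "('v::real_normed_vector \<Rightarrow>\<^sub>L 'h::real_normed_vector) \<Rightarrow> ('h \<Rightarrow> 'h dual) \<Rightarrow> ('v \<Rightarrow> 'v dual)
      \<Rightarrow> nat \<Rightarrow> real \<Rightarrow> (nat \<Rightarrow> 'v dual) \<Rightarrow> (nat \<Rightarrow> 'v) \<Rightarrow> bool" where
  "periodic_solution J M K N \<tau> f U \<longleftrightarrow>
     (\<forall>n\<in>{1..N}. restricted_op J M (periodic_diff N \<tau> U n) + K (U n) = f n)"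

definition iteration_step ::
    "('v::real_normed_vector \<Rightarrow>\<^sub>L 'h::real_normed_vector) \<Rightarrow> ('h \<Rightarrow> 'h dual) \<Rightarrow> ('v \<Rightarrow> 'v dual)
      \<Rightarrow> ('v \<Rightarrow> 'v dual) \<Rightarrow> nat \<Rightarrow> real \<Rightarrow> (nat \<Rightarrow> 'v dual) \<Rightarrow> (nat \<Rightarrow> 'v) \<Rightarrow> (nat \<Rightarrow> 'v) \<Rightarrow> bool" where
  "iteration_step J M K Khat N \<tau> f U U' \<longleftrightarrow>
     (\<forall>n\<in>{1..N}. restricted_op J M (periodic_diff N \<tau> U' n) + Khat (U' n)
                 = f n + Khat (U n) - K (U n))"

end

theory Submission
  imports Defs
begin

text \<open>
  The difference \<open>D\<close> of two new iterates satisfies \<open>M d\<^sub>\<tau> D\<^sup>n + Khat D\<^sup>n = R\<^sup>n\<close>, where the residual \<open>R\<^sup>n\<close> is bounded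
  by \<open>q\<close> times the difference of the old iterates. Testing with \<open>D\<^sup>n\<close> and summing over \<open>n\<close>, the contribution of \<open>M\<close>
  is nonnegative by periodicity, and Young's inequality turns the rest into the contraction estimate. Banach's
  fixed point theorem then gives the solution. The same theorem, applied to a cyclic implicit Euler step in the norm
  of \<open>M / \<tau> + Khat\<close>, shows that each linear iteration step is solvable.
\<close>

section \<open>Cyclic indices\<close>

text \<open>The convention \<open>u^0 = u^N\<close> is moved from the tuple to the index, so that
  the backward shift becomes a permutation of \<open>{1..N}\<close>.\<close>

definition cyclic_pred :: "nat \<Rightarrow> nat \<Rightarrow> nat" where
  "cyclic_pred N n = (if n = 1 then N else n - 1)"

lemma periodic_diff_eq: "periodic_diff N \<tau> U n = (1 / \<tau>) *\<^sub>R (U n - U (cyclic_pred N n))"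
  by (simp add: periodic_diff_def cyclic_pred_def)

text \<open>The cyclic shift permutes \<open>{1..N}\<close>; its inverse sends \<open>N\<close> to
  \<open>1\<close>. This is how periodicity enters: sums of \<open>h n - h (cyclic_pred N n)\<close>
  over one period vanish.\<close>

lemma sum_cyclic_pred:
  assumes "N \<ge> 1"
  shows "(\<Sum>n=1..N. h (cyclic_pred N n)) = (\<Sum>n=1..N. h n)"
  by (rule sum.reindex_bij_witness[of _ "\<lambda>n. if n = N then 1 else Suc n" "cyclic_pred N"])
    (use assms in \<open>auto simp: cyclic_pred_def\<close>)

section \<open>Nonnegative forms and their seminorms\<close>

text \<open>The form may degenerate, so \<open>op_norm A\<close> is in general only a seminorm. This
  covers the operator built from \<open>M\<close> as well as \<open>Khat\<close>.\<close>

locale nonneg_op =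
  fixes A :: "'v::real_normed_vector \<Rightarrow> 'v dual"
  assumes bounded_linear: "bounded_linear A"
    and symmetric: "symmetric_op A"
    and nonneg: "blinfun_apply (A u) u \<ge> 0"
begin

lemma sym: "blinfun_apply (A u) v = blinfun_apply (A v) u"
  using symmetric by (simp add: symmetric_op_def)

lemmas linear_simps = linear_add[OF bounded_linear.linear[OF bounded_linear]]
  linear_diff[OF bounded_linear.linear[OF bounded_linear]]
  linear_scale[OF bounded_linear.linear[OF bounded_linear]]
  linear_0[OF bounded_linear.linear[OF bounded_linear]]
  linear_neg[OF bounded_linear.linear[OF bounded_linear]]
  blinfun.bilinear_simps

lemma op_norm_nonneg: "op_norm A u \<ge> 0"
  by (simp add: op_norm_def nonneg)

lemma op_norm_square: "(op_norm A u)\<^sup>2 = blinfun_apply (A u) u"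
  by (simp add: op_norm_def nonneg)

lemma young: "2 * blinfun_apply (A u) v \<le> blinfun_apply (A u) u + blinfun_apply (A v) v"
  using nonneg[of "u - v"] sym[of v u] by (simp add: linear_simps)

text \<open>The discriminant argument. A degenerate \<open>v\<close> needs its own case because the
  quadratic in \<open>t\<close> then becomes affine.\<close>

lemma Cauchy_Schwarz: "blinfun_apply (A u) v \<le> op_norm A u * op_norm A v"
proof -
  have quadratic: "0 \<le> blinfun_apply (A u) u + 2 * t * blinfun_apply (A u) v + t\<^sup>2 * blinfun_apply (A v) v" for t
    using nonneg[of "u + t *\<^sub>R v"] sym[of v u]
    by (simp add: linear_simps power2_eq_square algebra_simps)
  have "(blinfun_apply (A u) v)\<^sup>2 \<le> blinfun_apply (A u) u * blinfun_apply (A v) v"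
  proof (cases "blinfun_apply (A v) v = 0")
    case True
    have "blinfun_apply (A u) v = 0"
    proof (rule ccontr)
      assume "blinfun_apply (A u) v \<noteq> 0"
      \<comment> \<open>A nonconstant affine function is unbounded below; at this \<open>t\<close>
        it would take the value \<open>-1\<close>.\<close>
      then show False
        using quadratic[of "- (blinfun_apply (A u) u + 1) / (2 * blinfun_apply (A u) v)"] True nonneg[of u]
        by (simp add: field_simps)
    qed
    then show ?thesis using True by simp
  next
    case False
    then have "blinfun_apply (A v) v > 0" using nonneg[of v] by simp
    \<comment> \<open>The chosen \<open>t\<close> is the minimizer of the quadratic.\<close>
    then show ?thesis
      using quadratic[of "- blinfun_apply (A u) v / blinfun_apply (A v) v"]
      by (simp add: field_simps power2_eq_square)
  qed
  then have "\<bar>blinfun_apply (A u) v\<bar> \<le> sqrt (blinfun_apply (A u) u * blinfun_apply (A v) v)"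
    using real_le_rsqrt by fastforce
  then show ?thesis by (simp add: op_norm_def real_sqrt_mult)
qed

lemma op_norm_triangle: "op_norm A (u + v) \<le> op_norm A u + op_norm A v"
proof (rule power2_le_imp_le)
  show "(op_norm A (u + v))\<^sup>2 \<le> (op_norm A u + op_norm A v)\<^sup>2"
    using Cauchy_Schwarz[of u v] sym[of v u] unfolding power2_sum op_norm_square
    by (simp add: linear_simps)
qed (simp add: op_norm_nonneg)

lemma op_norm_minus: "op_norm A (- u) = op_norm A u"
  by (simp add: op_norm_def linear_simps)

lemma op_norm_zero: "op_norm A 0 = 0"
  by (simp add: op_norm_def linear_simps)

lemma op_norm_le_norm: obtains b where "b > 0" "\<And>u. op_norm A u \<le> b * norm u"
proof -
  obtain B where B: "B > 0" "\<And>u. norm (A u) \<le> norm u * B"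
    using bounded_linear.pos_bounded[OF bounded_linear] by auto
  have "op_norm A u \<le> sqrt B * norm u" for u
  proof -
    have "blinfun_apply (A u) u \<le> norm (A u) * norm u"
      using norm_blinfun[of "A u" u] by simp
    also have "\<dots> \<le> B * (norm u)\<^sup>2"
      using mult_right_mono[OF B(2)[of u], of "norm u"] by (simp add: power2_eq_square ac_simps)
    finally have "sqrt (blinfun_apply (A u) u) \<le> sqrt (B * (norm u)\<^sup>2)"
      by (rule real_sqrt_le_mono)
    then show ?thesis
      by (simp add: op_norm_def real_sqrt_mult)
  qed
  then show thesis using that[of "sqrt B"] B by simp
qed

lemma tuple_op_norm_nonneg: "tuple_op_norm N A U \<ge> 0"
  by (simp add: tuple_op_norm_def sum_nonneg)

lemma tuple_op_norm_L2_set: "tuple_op_norm N A U = L2_set (\<lambda>n. op_norm A (U n)) {1..N}"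
  by (simp add: tuple_op_norm_def L2_set_def)

text \<open>Minkowski's inequality, applied to the seminorms of the components.\<close>

lemma tuple_op_norm_triangle:
  "tuple_op_norm N A (\<lambda>n. U n + V n) \<le> tuple_op_norm N A U + tuple_op_norm N A V"
proof -
  have "L2_set (\<lambda>n. op_norm A (U n + V n)) {1..N} \<le> L2_set (\<lambda>n. op_norm A (U n) + op_norm A (V n)) {1..N}"
    by (intro L2_set_mono op_norm_triangle op_norm_nonneg)
  also have "\<dots> \<le> L2_set (\<lambda>n. op_norm A (U n)) {1..N} + L2_set (\<lambda>n. op_norm A (V n)) {1..N}"
    by (rule L2_set_triangle_ineq)
  finally show ?thesis by (simp add: tuple_op_norm_L2_set)
qed

end

section \<open>Elliptic operators and their inverses\<close>

text \<open>The form of \<open>A\<close> acts as an inner product. Ellipticity and boundedness make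
  its norm equivalent to the given one, so that completeness carries over to it.\<close>

locale elliptic_symmetric_op = nonneg_op A for A :: "'v::{real_normed_vector,complete_space} \<Rightarrow> 'v dual" +
  assumes elliptic: "elliptic_op A"
begin

lemma norm_le_op_norm: obtains a where "a > 0" "\<And>u. a * norm u \<le> op_norm A u"
proof -
  obtain \<alpha> where "\<alpha> > 0" and \<alpha>: "\<And>u. blinfun_apply (A u) u \<ge> \<alpha> * (norm u)\<^sup>2"
    using elliptic by (auto simp: elliptic_op_def)
  have "sqrt \<alpha> * norm u \<le> op_norm A u" for u
    using real_sqrt_le_mono[OF \<alpha>[of u]] by (simp add: op_norm_def real_sqrt_mult)
  then show thesis using that[of "sqrt \<alpha>"] \<open>\<alpha> > 0\<close> by simp
qed

lemma op_norm_eq_0_iff: "op_norm A u = 0 \<longleftrightarrow> u = 0"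
proof
  obtain a where a: "a > 0" "\<And>u. a * norm u \<le> op_norm A u" using norm_le_op_norm by blast
  assume "op_norm A u = 0"
  then have "a * norm u \<le> 0" using a(2)[of u] by simp
  then show "u = 0" using a(1) by (simp add: mult_le_0_iff)
qed (simp add: op_norm_zero)

lemma inj_op: "inj A"
proof (rule injI)
  fix u v assume "A u = A v"
  then have "op_norm A (u - v) = 0" by (simp add: op_norm_def linear_simps)
  then show "u = v" by (simp add: op_norm_eq_0_iff)
qed

lemma Cauchy_if_op_norm:
  assumes "\<And>e. e > 0 \<Longrightarrow> \<exists>m. \<forall>k\<ge>m. \<forall>l\<ge>m. op_norm A (x k - x l) < e"
  shows "Cauchy x"
proof -
  obtain a where a: "a > 0" "\<And>u. a * norm u \<le> op_norm A u"
    using norm_le_op_norm by blast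
  show ?thesis
  proof (rule CauchyI)
    fix e :: real assume "e > 0"
    then obtain m where m: "\<forall>k\<ge>m. \<forall>l\<ge>m. op_norm A (x k - x l) < a * e"
      using assms[of "a * e"] a by auto
    have "norm (x k - x l) < e" if "k \<ge> m" "l \<ge> m" for k l
      using m that a(2)[of "x k - x l"] a(1) by (smt (verit) mult_less_cancel_left_pos)
    then show "\<exists>m. \<forall>k\<ge>m. \<forall>l\<ge>m. norm (x k - x l) < e" by blast
  qed
qed

lemma tendsto_op_norm:
  assumes "x \<longlonglongrightarrow> l"
  shows "(\<lambda>k. op_norm A (x k - l)) \<longlonglongrightarrow> 0"
proof -
  obtain b where b: "\<And>u. op_norm A u \<le> b * norm u" using op_norm_le_norm by blast
  have "(\<lambda>k. b * norm (x k - l)) \<longlonglongrightarrow> b * 0"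
    using assms by (intro tendsto_mult_left) (simp add: LIM_zero_iff tendsto_norm_zero_iff)
  then have upper: "(\<lambda>k. b * norm (x k - l)) \<longlonglongrightarrow> 0" by simp
  show ?thesis
    by (rule real_tendsto_sandwich[OF _ _ tendsto_const upper]) (simp_all add: op_norm_nonneg b)
qed

text \<open>The preimage of \<open>g\<close> minimizes the energy \<open>A u u - 2 g u\<close>; minimizing sequences are
  Cauchy by the parallelogram law.\<close>

lemma surj_op: "surj A"
proof (rule surjI)
  fix g :: "'v dual"
  define E where "E u = blinfun_apply (A u) u - 2 * blinfun_apply g u" for u
  obtain a where a: "a > 0" "\<And>u. a * norm u \<le> op_norm A u" using norm_le_op_norm by blast
  have lower: "E u \<ge> - (norm g / a)\<^sup>2" for u
  proof -
    have "blinfun_apply g u \<le> norm g * norm u" using norm_blinfun[of g u] by simp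
    moreover have "(a * norm u)\<^sup>2 \<le> blinfun_apply (A u) u"
      using power_mono[OF a(2)[of u], of 2] a(1) by (simp add: op_norm_square)
    \<comment> \<open>Young's inequality, weighted so that the cross term is exactly
      \<open>norm g * norm u\<close>.\<close>
    moreover have "0 \<le> (a * norm u - norm g / a)\<^sup>2" by simp
    then have "2 * (norm g * norm u) \<le> (a * norm u)\<^sup>2 + (norm g / a)\<^sup>2"
      using a(1) by (simp add: power2_diff ac_simps)
    ultimately show ?thesis unfolding E_def by linarith
  qed
  define m where "m = Inf (range E)"
  have bdd: "bdd_below (range E)" by (rule bdd_belowI[of _ "- (norm g / a)\<^sup>2"]) (use lower in auto)
  have m: "m \<le> E u" for u unfolding m_def using bdd by (simp add: cINF_lower)
  have "\<exists>u. E u < m + 1 / real (Suc k)" for k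
    using cInf_lessD[of "range E" "m + 1 / real (Suc k)"] unfolding m_def by auto
  then obtain x where x: "\<And>k. E (x k) < m + 1 / real (Suc k)" by metis
  \<comment> \<open>The parallelogram law for the form; the terms with \<open>g\<close> cancel
    because \<open>g\<close> is linear.\<close>
  have parallelogram: "(op_norm A (u - v))\<^sup>2 = 2 * E u + 2 * E v - 4 * E ((1/2) *\<^sub>R (u + v))" for u v
    unfolding op_norm_square E_def using sym[of v u] by (simp add: linear_simps algebra_simps)
  have "Cauchy x"
  proof (rule Cauchy_if_op_norm)
    fix e :: real assume "e > 0"
    \<comment> \<open>From index \<open>n\<close> on, the energies exceed \<open>m\<close> by less
      than \<open>1 / real (Suc n)\<close>, while the midpoint has energy at least \<open>m\<close>.
      The squared distance is thus below four times this excess.\<close>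
    then obtain n where n: "1 / real (Suc n) < e\<^sup>2 / 4"
      using nat_approx_posE[of "e\<^sup>2 / 4"] by auto
    have "op_norm A (x k - x l) < e" if "k \<ge> n" "l \<ge> n" for k l
    proof (rule power2_less_imp_less)
      have "1 / real (Suc k) \<le> 1 / real (Suc n)" "1 / real (Suc l) \<le> 1 / real (Suc n)"
        using that by (auto intro!: divide_left_mono)
      then show "(op_norm A (x k - x l))\<^sup>2 < e\<^sup>2"
        using parallelogram[of "x k" "x l"] x[of k] x[of l] m[of "(1/2) *\<^sub>R (x k + x l)"] n by linarith
    qed (use \<open>e > 0\<close> in simp)
    then show "\<exists>m. \<forall>k\<ge>m. \<forall>l\<ge>m. op_norm A (x k - x l) < e" by blast
  qed
  then obtain v where v: "x \<longlonglongrightarrow> v" using Cauchy_convergent convergent_def by metis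
  have "(\<lambda>k. E (x k)) \<longlonglongrightarrow> E v"
    unfolding E_def
    by (intro tendsto_intros v bounded_linear.tendsto[OF bounded_linear] blinfun.tendsto)
  moreover have "(\<lambda>k. m + 1 / real (Suc k)) \<longlonglongrightarrow> m + 0"
    using LIMSEQ_inverse_real_of_nat by (intro tendsto_intros) (simp add: inverse_eq_divide)
  ultimately have "E v \<le> m"
    using x by (intro LIMSEQ_le[of "\<lambda>k. E (x k)" _ "\<lambda>k. m + 1 / real (Suc k)"]) (auto intro: less_imp_le)
  then have min: "E v \<le> E u" for u using m[of u] by linarith
  have "blinfun_apply (A v) w = blinfun_apply g w" for w
  proof -
    \<comment> \<open>Half the derivative of \<open>E\<close> at \<open>v\<close> in direction
      \<open>w\<close>; minimality will make it vanish.\<close>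
    define s where "s = blinfun_apply (A v) w - blinfun_apply g w"
    have quadratic: "0 \<le> 2 * t * s + t\<^sup>2 * blinfun_apply (A w) w" for t
      using min[of "v + t *\<^sub>R w"] sym[of w v] unfolding E_def s_def
      by (simp add: linear_simps power2_eq_square algebra_simps)
    \<comment> \<open>The added \<open>1\<close> keeps the divisor positive even for
      \<open>w = 0\<close>.\<close>
    define c where "c = blinfun_apply (A w) w + 1"
    have c: "c > 0" using nonneg[of w] by (simp add: c_def)
    have "0 \<le> 2 * (- s / c) * s + (- s / c)\<^sup>2 * c - (- s / c)\<^sup>2"
      using quadratic[of "- s / c"] by (simp add: c_def algebra_simps)
    also have "\<dots> = - (s\<^sup>2 / c) - (s / c)\<^sup>2"
      using c by (simp add: field_simps power2_eq_square)
    finally have "s\<^sup>2 / c \<le> 0" using zero_le_power2[of "s / c"] by linarith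
    then have "s = 0" using c by (simp add: divide_le_0_iff)
    then show ?thesis by (simp add: s_def)
  qed
  then have "A v = g" by (intro blinfun_eqI)
  then show "A (inv A g) = g" by (metis f_inv_into_f rangeI)
qed

lemma A_inv: "A (inv A g) = g"
  by (simp add: surj_op surj_f_inv_f)

lemma inv_A: "inv A (A u) = u"
  by (simp add: inj_op)

text \<open>\<open>inv A g\<close> is the Riesz representative of \<open>g\<close> for the form of
  \<open>A\<close>, so bounds in the dual norm reduce to bounds in \<open>op_norm A\<close>.\<close>

lemma op_dual_norm_eq: "op_dual_norm A g = op_norm A (inv A g)"
  by (simp add: op_dual_norm_def op_norm_def A_inv)

section \<open>The complete metric space of tuples\<close>

definition tuple_dist :: "nat \<Rightarrow> (nat \<Rightarrow> 'v) \<Rightarrow> (nat \<Rightarrow> 'v) \<Rightarrow> real" where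
  "tuple_dist N U V = tuple_op_norm N A (\<lambda>n. U n - V n)"

lemma op_norm_le_tuple_dist: "n \<in> {1..N} \<Longrightarrow> op_norm A (U n - V n) \<le> tuple_dist N U V"
  unfolding tuple_dist_def tuple_op_norm_L2_set by (intro member_le_L2_set) auto

text \<open>Separation combines definiteness of the form on the indices in \<open>{1..N}\<close>
  with extensionality of tuples outside them.\<close>

lemma Metric_space_tuples: "Metric_space (tuples N) (tuple_dist N)"
proof
  fix U V W :: "nat \<Rightarrow> 'v"
  show "0 \<le> tuple_dist N U V" by (simp add: tuple_dist_def tuple_op_norm_nonneg)
  show "tuple_dist N U V = tuple_dist N V U"
    unfolding tuple_dist_def tuple_op_norm_def using op_norm_minus[of "U n - V n" for n] by simp
  show "tuple_dist N U W \<le> tuple_dist N U V + tuple_dist N V W"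
    unfolding tuple_dist_def using tuple_op_norm_triangle[of N "\<lambda>n. U n - V n" "\<lambda>n. V n - W n"] by simp
  assume "U \<in> tuples N" "V \<in> tuples N"
  then show "tuple_dist N U V = 0 \<longleftrightarrow> U = V"
    unfolding tuple_dist_def tuple_op_norm_L2_set tuples_def
    by (auto simp: L2_set_eq_0_iff op_norm_eq_0_iff intro: PiE_ext)
qed

lemma tuple_dist_tendsto_0:
  assumes "\<And>n. n \<in> {1..N} \<Longrightarrow> (\<lambda>k. x k n) \<longlonglongrightarrow> l n"
  shows "(\<lambda>k. tuple_dist N (x k) l) \<longlonglongrightarrow> 0"
proof -
  have "(\<lambda>k. sqrt (\<Sum>n=1..N. (op_norm A (x k n - l n))\<^sup>2)) \<longlonglongrightarrow> sqrt (\<Sum>n=1..N. 0\<^sup>2)"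
    using assms by (intro tendsto_intros tendsto_op_norm)
  then show ?thesis by (simp add: tuple_dist_def tuple_op_norm_def)
qed

text \<open>A Cauchy sequence of tuples is Cauchy in each component, hence converges there by
  ellipticity and completeness. The finitely many limits are assembled into a tuple by
  \<open>restrict\<close>.\<close>

lemma mcomplete_tuples: "Metric_space.mcomplete (tuples N) (tuple_dist N)"
proof -
  note metric = Metric_space_tuples[of N]
  show ?thesis unfolding Metric_space.mcomplete_def[OF metric]
  proof (intro allI impI)
    fix x assume "Metric_space.MCauchy (tuples N) (tuple_dist N) x"
    then have x: "range x \<subseteq> tuples N"
      and cauchy: "\<And>e. e > 0 \<Longrightarrow> \<exists>m. \<forall>k l. m \<le> k \<longrightarrow> m \<le> l \<longrightarrow> tuple_dist N (x k) (x l) < e"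
      unfolding Metric_space.MCauchy_def[OF metric] by blast+
    have "\<exists>l. (\<lambda>k. x k n) \<longlonglongrightarrow> l" if n: "n \<in> {1..N}" for n
    proof -
      have "Cauchy (\<lambda>k. x k n)"
        using cauchy op_norm_le_tuple_dist[OF n] by (intro Cauchy_if_op_norm) (meson le_less_trans)
      then show ?thesis using Cauchy_convergent convergent_def by blast
    qed
    then obtain l where l: "\<And>n. n \<in> {1..N} \<Longrightarrow> (\<lambda>k. x k n) \<longlonglongrightarrow> l n" by metis
    have "limitin (Metric_space.mtopology (tuples N) (tuple_dist N)) x (restrict l {1..N}) sequentially"
      unfolding Metric_space.limitin_metric_dist_null[OF metric]
    proof (intro conjI)
      show "restrict l {1..N} \<in> tuples N" by (simp add: tuples_def)
      show "\<forall>\<^sub>F k in sequentially. x k \<in> tuples N" using x by (intro always_eventually) blast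
      show "(\<lambda>k. tuple_dist N (x k) (restrict l {1..N})) \<longlonglongrightarrow> 0"
        by (rule tuple_dist_tendsto_0) (use l in simp)
    qed
    then show "\<exists>l. limitin (Metric_space.mtopology (tuples N) (tuple_dist N)) x l sequentially" by blast
  qed
qed

text \<open>Banach's fixed point theorem. The condition \<open>k < 1\<close> puts no sign on
  \<open>k\<close>, which matches what is known about \<open>q\<close>.\<close>

lemma tuples_fixpoint:
  assumes F: "F \<in> tuples N \<rightarrow> tuples N" and "k < 1"
    and contr: "\<And>U V. U \<in> tuples N \<Longrightarrow> V \<in> tuples N \<Longrightarrow> tuple_dist N (F U) (F V) \<le> k * tuple_dist N U V"
  shows "\<exists>!U. U \<in> tuples N \<and> F U = U"
proof -
  note metric = Metric_space_tuples[of N]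
  have nonempty: "tuples N \<noteq> ({} :: (nat \<Rightarrow> 'v) set)"
    by (simp add: tuples_def PiE_eq_empty_iff)
  obtain U where U: "U \<in> tuples N" "F U = U"
    using Metric_space.Banach_fixedpoint_thm[where f = F and k = k, OF metric mcomplete_tuples nonempty F \<open>k < 1\<close>]
      contr by blast
  moreover have "V = U" if V: "V \<in> tuples N" "F V = V" for V
    using Metric_space.contraction_imp_unique_fixpoint[where f = F and k = k and x = V and y = U,
        OF metric V(2) U(2) F \<open>k < 1\<close>] contr V(1) U(1) by blast
  ultimately show ?thesis by blast
qed

section \<open>Estimates and solvability for periodic systems\<close>

text \<open>Testing with \<open>D n\<close> and summing over one period, the terms containing \<open>P\<close> telescope up to a
  nonnegative remainder.\<close>

lemma periodic_energy_estimate: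
  assumes P: "nonneg_op P" and N: "N \<ge> 1"
    and eq: "\<And>n. n \<in> {1..N} \<Longrightarrow> P (D n - D (cyclic_pred N n)) + A (D n) = R n"
  shows "tuple_op_norm N A D \<le> L2_set (\<lambda>n. op_dual_norm A (R n)) {1..N}"
proof -
  interpret P: nonneg_op P by (rule P)
  \<comment> \<open>The tested equation is doubled. Young's inequality for \<open>P\<close> splits
    the mixed term into diagonal ones; for \<open>A\<close> it absorbs half of the elliptic term,
    which leaves the constant one.\<close>
  have step: "blinfun_apply (P (D n)) (D n) - blinfun_apply (P (D (cyclic_pred N n))) (D (cyclic_pred N n))
      + (op_norm A (D n))\<^sup>2 \<le> (op_dual_norm A (R n))\<^sup>2" if n: "n \<in> {1..N}" for n
  proof -
    have "blinfun_apply (P (D n)) (D n) - blinfun_apply (P (D (cyclic_pred N n))) (D n) + blinfun_apply (A (D n)) (D n)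
        = blinfun_apply (R n) (D n)"
      unfolding eq[OF n, symmetric] by (simp add: P.linear_simps)
    moreover have "2 * blinfun_apply (R n) (D n) \<le> (op_dual_norm A (R n))\<^sup>2 + (op_norm A (D n))\<^sup>2"
      using young[of "inv A (R n)" "D n"] by (simp add: op_dual_norm_eq op_norm_square A_inv)
    ultimately show ?thesis
      using P.young[of "D (cyclic_pred N n)" "D n"] by (simp add: op_norm_square)
  qed
  have "(\<Sum>n=1..N. blinfun_apply (P (D n)) (D n) - blinfun_apply (P (D (cyclic_pred N n))) (D (cyclic_pred N n))
      + (op_norm A (D n))\<^sup>2) \<le> (\<Sum>n=1..N. (op_dual_norm A (R n))\<^sup>2)"
    by (rule sum_mono) (rule step)
  then have "(\<Sum>n=1..N. (op_norm A (D n))\<^sup>2) \<le> (\<Sum>n=1..N. (op_dual_norm A (R n))\<^sup>2)"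
    using sum_cyclic_pred[OF N, of "\<lambda>n. blinfun_apply (P (D n)) (D n)"]
    by (simp add: sum.distrib sum_subtractf)
  then show ?thesis
    by (simp add: tuple_op_norm_def L2_set_def)
qed

text \<open>With \<open>S = P + A\<close> the system reads \<open>W n = S\<inverse> (g n + P (W (n - 1)))\<close> cyclically. Since \<open>P \<le> k\<^sup>2 S\<close> as forms
  for some \<open>k < 1\<close>, the right-hand side is a contraction in the norm of \<open>S\<close>.\<close>

lemma linear_periodic_problem:
  assumes P: "nonneg_op P" and N: "N \<ge> 1"
  shows "\<exists>!W. W \<in> tuples N \<and> (\<forall>n\<in>{1..N}. P (W n - W (cyclic_pred N n)) + A (W n) = g n)"
proof -
  interpret P: nonneg_op P by (rule P)
  define S where "S u = P u + A u" for u
  interpret S: elliptic_symmetric_op S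
  proof (intro elliptic_symmetric_op.intro nonneg_op.intro elliptic_symmetric_op_axioms.intro)
    show "bounded_linear S" unfolding S_def
      by (intro bounded_linear_add P.bounded_linear bounded_linear)
    show "symmetric_op S"
      using sym P.sym by (simp add: symmetric_op_def S_def plus_blinfun.rep_eq)
    show "blinfun_apply (S u) u \<ge> 0" for u
      using nonneg P.nonneg by (simp add: S_def plus_blinfun.rep_eq)
    obtain \<alpha> where "\<alpha> > 0" "\<And>u. blinfun_apply (A u) u \<ge> \<alpha> * (norm u)\<^sup>2"
      using elliptic by (auto simp: elliptic_op_def)
    then show "elliptic_op S"
      unfolding elliptic_op_def S_def plus_blinfun.rep_eq using P.nonneg by (smt (verit))
  qed
  obtain a where a: "a > 0" "\<And>u. a * norm u \<le> op_norm A u"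
    using norm_le_op_norm by blast
  obtain b where b: "b > 0" "\<And>u. op_norm P u \<le> b * norm u"
    using P.op_norm_le_norm by blast
  \<comment> \<open>The forms satisfy \<open>P \<le> b^2\<close> and \<open>A \<ge> a^2\<close>
    relative to the squared norm, so the ratio of \<open>P\<close> to \<open>P + A\<close> is at
    most \<open>b^2 / (a^2 + b^2)\<close>.\<close>
  define k where "k = b / sqrt (a\<^sup>2 + b\<^sup>2)"
  have less: "b < sqrt (a\<^sup>2 + b\<^sup>2)"
    using a(1) by (intro real_less_rsqrt) simp
  have k: "0 < k" "k < 1"
    using divide_pos_pos[OF b(1) less_trans[OF b(1) less]]
      divide_less_eq_1_pos[OF less_trans[OF b(1) less], of b] less by (simp_all only: k_def)
  have P_le: "op_norm P u \<le> k * op_norm S u" for u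
  proof -
    have "a * op_norm P u \<le> b * op_norm A u"
    proof -
      have "a * op_norm P u \<le> b * (a * norm u)" using b(2)[of u] a(1) by simp
      also have "\<dots> \<le> b * op_norm A u" using a(2)[of u] b(1) by simp
      finally show ?thesis .
    qed
    then have "(a * op_norm P u)\<^sup>2 \<le> (b * op_norm A u)\<^sup>2"
      using a(1) by (intro power_mono) (simp_all add: P.op_norm_nonneg)
    \<comment> \<open>The form of \<open>P\<close>, multiplied by \<open>b^2\<close>, is added on
      both sides to complete \<open>A\<close> to \<open>S\<close>.\<close>
    then have "(a\<^sup>2 + b\<^sup>2) * (op_norm P u)\<^sup>2 \<le> b\<^sup>2 * (op_norm S u)\<^sup>2"
      unfolding power_mult_distrib P.op_norm_square op_norm_square S.op_norm_square
      by (simp add: S_def plus_blinfun.rep_eq algebra_simps)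
    then have "sqrt ((a\<^sup>2 + b\<^sup>2) * (op_norm P u)\<^sup>2) \<le> sqrt (b\<^sup>2 * (op_norm S u)\<^sup>2)"
      by (rule real_sqrt_le_mono)
    then have "sqrt (a\<^sup>2 + b\<^sup>2) * op_norm P u \<le> b * op_norm S u"
      using b(1) by (simp add: real_sqrt_mult P.op_norm_nonneg S.op_norm_nonneg)
    moreover have "sqrt (a\<^sup>2 + b\<^sup>2) > 0" using a(1) by (simp add: add_pos_nonneg)
    ultimately show ?thesis by (simp add: k_def field_simps)
  qed
  have contr: "op_norm S (inv S (P u)) \<le> k * op_norm S u" for u
  proof -
    define z where "z = inv S (P u)"
    \<comment> \<open>The equation \<open>S z = P u\<close> is tested with \<open>z\<close>.
      Cauchy-Schwarz for \<open>P\<close> yields the factor \<open>k\<close> twice; one of them is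
      estimated by \<open>1\<close>.\<close>
    have "(op_norm S z)\<^sup>2 = blinfun_apply (P u) z"
      by (simp add: S.op_norm_square z_def S.A_inv)
    also have "\<dots> \<le> op_norm P u * op_norm P z" by (rule P.Cauchy_Schwarz)
    also have "\<dots> \<le> (k * op_norm S u) * (k * op_norm S z)"
      using k by (intro mult_mono P_le) (simp_all add: P.op_norm_nonneg S.op_norm_nonneg)
    also have "\<dots> \<le> (k * op_norm S u) * (1 * op_norm S z)"
      using k by (intro mult_left_mono mult_right_mono) (simp_all add: S.op_norm_nonneg)
    finally have "op_norm S z * op_norm S z \<le> (k * op_norm S u) * op_norm S z"
      by (simp add: power2_eq_square)
    then have "op_norm S z \<le> k * op_norm S u"
      using k S.op_norm_nonneg[of z] S.op_norm_nonneg[of u]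
      by (cases "op_norm S z = 0") (auto simp: mult_le_cancel_right)
    then show ?thesis by (simp add: z_def)
  qed
  \<comment> \<open>A Jacobi-type sweep: every component is updated from the old tuple, so no
    component waits for another around the cycle.\<close>
  define F where "F W = restrict (\<lambda>n. inv S (g n + P (W (cyclic_pred N n)))) {1..N}" for W
  have "\<exists>!W. W \<in> tuples N \<and> F W = W"
  proof (rule S.tuples_fixpoint)
    show "F \<in> tuples N \<rightarrow> tuples N" by (auto simp: F_def tuples_def)
    show "k < 1" by (rule k)
    fix U V :: "nat \<Rightarrow> 'v"
    define E where "E n = U n - V n" for n
    have "F U n - F V n = inv S (P (E (cyclic_pred N n)))" if "n \<in> {1..N}" for n
    proof -
      have "S (F U n - F V n) = P (E (cyclic_pred N n))"
        using that by (simp add: F_def S.linear_simps S.A_inv E_def P.linear_simps)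
      then show ?thesis by (metis S.inv_A)
    qed
    then have "S.tuple_dist N (F U) (F V) = L2_set (\<lambda>n. op_norm S (inv S (P (E (cyclic_pred N n))))) {1..N}"
      unfolding S.tuple_dist_def S.tuple_op_norm_L2_set by (intro L2_set_cong) auto
    also have "\<dots> \<le> L2_set (\<lambda>n. k * op_norm S (E (cyclic_pred N n))) {1..N}"
      by (intro L2_set_mono contr S.op_norm_nonneg)
    also have "\<dots> = k * L2_set (\<lambda>n. op_norm S (E (cyclic_pred N n))) {1..N}"
      using k by (simp add: L2_set_right_distrib)
    \<comment> \<open>The cyclic shift only permutes the summands.\<close>
    also have "L2_set (\<lambda>n. op_norm S (E (cyclic_pred N n))) {1..N} = S.tuple_dist N U V"
      using sum_cyclic_pred[OF N, of "\<lambda>n. (op_norm S (E n))\<^sup>2"]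
      by (simp add: L2_set_def S.tuple_dist_def tuple_op_norm_def E_def)
    finally show "S.tuple_dist N (F U) (F V) \<le> k * S.tuple_dist N U V" .
  qed
  moreover have "F W = W \<longleftrightarrow> (\<forall>n\<in>{1..N}. P (W n - W (cyclic_pred N n)) + A (W n) = g n)"
    if W: "W \<in> tuples N" for W
  proof -
    have "F W \<in> tuples N" by (simp add: F_def tuples_def)
    then have "F W = W \<longleftrightarrow> (\<forall>n\<in>{1..N}. F W n = W n)"
      using W unfolding tuples_def by (metis PiE_ext)
    also have "\<dots> \<longleftrightarrow> (\<forall>n\<in>{1..N}. g n + P (W (cyclic_pred N n)) = S (W n))"
      by (intro ball_cong refl) (auto simp: F_def S.inv_A S.A_inv; metis S.A_inv S.inv_A)
    also have "\<dots> \<longleftrightarrow> (\<forall>n\<in>{1..N}. P (W n - W (cyclic_pred N n)) + A (W n) = g n)"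
      by (intro ball_cong refl) (auto simp: S_def P.linear_simps algebra_simps)
    finally show ?thesis .
  qed
  ultimately show ?thesis by (metis (no_types, lifting))
qed

text \<open>Here \<open>D\<close> stands for the difference of two new iterates, \<open>E\<close>
  for that of the old ones, and \<open>R\<close> for the difference of the right-hand sides; the
  energy estimate is combined with the bound on \<open>R\<close>.\<close>

lemma iteration_contraction:
  assumes P: "nonneg_op P" and N: "N \<ge> 1"
    and eq: "\<And>n. n \<in> {1..N} \<Longrightarrow> P (D n - D (cyclic_pred N n)) + A (D n) = R n"
    and R: "\<And>n. n \<in> {1..N} \<Longrightarrow> op_dual_norm A (R n) \<le> q * op_norm A (E n)"
  shows "tuple_op_norm N A D \<le> q * tuple_op_norm N A E"
proof -
  have "tuple_op_norm N A D \<le> L2_set (\<lambda>n. op_dual_norm A (R n)) {1..N}"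
    using periodic_energy_estimate[where P = P and D = D and R = R] P N eq by blast
  also have "\<dots> \<le> L2_set (\<lambda>n. q * op_norm A (E n)) {1..N}"
    by (intro L2_set_mono R) (simp_all add: op_dual_norm_eq op_norm_nonneg)
  also have "\<dots> = q * tuple_op_norm N A E"
  proof (cases "q \<ge> 0")
    case True
    then show ?thesis by (simp add: tuple_op_norm_L2_set L2_set_right_distrib)
  next
    \<comment> \<open>A negative \<open>q\<close> forces every \<open>E n\<close> to have norm zero,
      so both sides vanish.\<close>
    case False
    have "op_norm A (E n) = 0" if "n \<in> {1..N}" for n
    proof -
      have "0 \<le> q * op_norm A (E n)"
        using R[OF that] op_norm_nonneg[of "inv A (R n)"] by (simp add: op_dual_norm_eq)
      then show ?thesis using False op_norm_nonneg[of "E n"] by (simp add: zero_le_mult_iff)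
    qed
    then show ?thesis by (simp add: tuple_op_norm_def L2_set_def)
  qed
  finally show ?thesis .
qed

end

section \<open>Restriction of \<open>M\<close> to the smaller space\<close>

text \<open>Pulling the form of \<open>M\<close> back along \<open>J\<close> preserves symmetry and
  nonnegativity. The factor \<open>s\<close> will be \<open>1 / \<tau>\<close>, placed inside the
  argument as in \<open>periodic_diff\<close>.\<close>

lemma nonneg_op_restricted:
  fixes J :: "'v::real_normed_vector \<Rightarrow>\<^sub>L 'h::real_normed_vector"
  assumes lin: "linear M" and bd: "\<And>u. norm (M u) \<le> C * norm u" and sym: "symmetric_op M"
    and nn: "\<And>u. blinfun_apply (M u) u \<ge> 0" and s: "s \<ge> 0"
  shows "nonneg_op (\<lambda>u. restricted_op J M (s *\<^sub>R u))"
proof (rule nonneg_op.intro)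
  have M: "bounded_linear M"
    using lin bd by (intro bounded_linear_intro[of M C])
      (auto simp: linear_add linear_scale mult.commute)
  have "bounded_linear (\<lambda>u. M (blinfun_apply J (s *\<^sub>R u)) o\<^sub>L J)"
    by (intro bounded_linear_compose[OF bounded_bilinear.bounded_linear_left[OF bounded_bilinear_blinfun_compose]]
        bounded_linear_compose[OF M] bounded_linear_compose[OF blinfun.bounded_linear_right]
        bounded_linear_scaleR_right)
  then show "bounded_linear (\<lambda>u. restricted_op J M (s *\<^sub>R u))" by (simp add: restricted_op_def)
  show "symmetric_op (\<lambda>u. restricted_op J M (s *\<^sub>R u))"
    using sym by (simp add: symmetric_op_def restricted_op_def blinfun.scaleR_right
        linear_scale[OF lin] scaleR_blinfun.rep_eq)
  show "blinfun_apply (restricted_op J M (s *\<^sub>R u)) u \<ge> 0" for u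
    using nn s by (simp add: restricted_op_def blinfun.scaleR_right
        linear_scale[OF lin] scaleR_blinfun.rep_eq)
qed

section \<open>Convergence for the nonlinear problem\<close>

theorem theorem3:
  fixes J :: "'v::{real_inner,complete_space} \<Rightarrow>\<^sub>L 'h::{real_inner,complete_space}"
    and K Khat :: "'v \<Rightarrow> 'v dual"
    and M :: "'h \<Rightarrow> 'h dual"
    and f :: "nat \<Rightarrow> 'v dual"
    and L \<gamma> C T \<tau> q :: real
    and N :: nat
  assumes J_inj: "inj (blinfun_apply J)"
    and consts_pos: "L > 0" "\<gamma> > 0"
    and K_strongly_monotone:
      "\<And>u v. blinfun_apply (K u - K v) (u - v) \<ge> \<gamma> * (norm (u - v))\<^sup>2"
    and K_Lipschitz: "\<And>u v. norm (K u - K v) \<le> L * norm (u - v)"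
    and M_linear: "linear M"
    and M_bounded: "\<And>u. norm (M u) \<le> C * norm u"
    and M_symmetric: "symmetric_op M"
    and M_nonneg: "\<And>u. blinfun_apply (M u) u \<ge> 0"
    and T_pos: "T > 0"
    and N_ge_1: "N \<ge> 1"
    and tau: "\<tau> = T / real N"
    and Khat_linear_continuous: "bounded_linear Khat"
    and Khat_symmetric: "symmetric_op Khat"
    and Khat_elliptic: "elliptic_op Khat"
    and q_less_1: "q < 1"
    and contraction: "\<And>u v. op_dual_norm Khat (Khat (u - v) - (K u - K v)) \<le> q * op_norm Khat (u - v)"
  shows "\<exists>U\<in>tuples N.
     (\<forall>W\<in>tuples N. periodic_solution J M K N \<tau> f W \<longleftrightarrow> W = U) \<and>
     (\<forall>W\<in>tuples N. \<exists>!W'. W' \<in> tuples N \<and> iteration_step J M K Khat N \<tau> f W W') \<and>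
     (\<forall>U0\<in>tuples N. \<forall>Us :: nat \<Rightarrow> nat \<Rightarrow> 'v.
        Us 0 = U0 \<and>
        (\<forall>k. Us (Suc k) \<in> tuples N \<and> iteration_step J M K Khat N \<tau> f (Us k) (Us (Suc k))) \<longrightarrow>
        (\<forall>k. tuple_op_norm N Khat (\<lambda>n. Us (Suc k) n - U n)
              \<le> q * tuple_op_norm N Khat (\<lambda>n. Us k n - U n)) \<and>
        (\<lambda>k. tuple_op_norm N Khat (\<lambda>n. Us k n - U n)) \<longlonglongrightarrow> 0)"
proof -
  define P where "P u = restricted_op J M ((1 / \<tau>) *\<^sub>R u)" for u
  have "\<tau> > 0" using T_pos N_ge_1 tau by simp
  then have P: "nonneg_op P"
    unfolding P_def using M_linear M_bounded M_symmetric M_nonneg by (intro nonneg_op_restricted) auto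
  interpret P: nonneg_op P by (rule P)
  interpret elliptic_symmetric_op Khat
  proof (intro elliptic_symmetric_op.intro nonneg_op.intro elliptic_symmetric_op_axioms.intro)
    show "blinfun_apply (Khat u) u \<ge> 0" for u
      using Khat_elliptic by (auto simp: elliptic_op_def intro: order_trans[rotated])
  qed (fact Khat_linear_continuous Khat_symmetric Khat_elliptic)+
  let ?step = "iteration_step J M K Khat N \<tau> f"
  have step_iff: "?step U U' \<longleftrightarrow>
      (\<forall>n\<in>{1..N}. P (U' n - U' (cyclic_pred N n)) + Khat (U' n) = f n + Khat (U n) - K (U n))" for U U'
    by (simp add: iteration_step_def periodic_diff_eq P_def)
  \<comment> \<open>For equal old and new iterates the terms with \<open>Khat\<close> cancel, so
    solutions are exactly the fixed points of the iteration.\<close>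
  have solution_iff: "periodic_solution J M K N \<tau> f U \<longleftrightarrow> ?step U U" for U
    unfolding periodic_solution_def iteration_step_def by (intro ball_cong refl) (auto simp: algebra_simps)
  have step: "\<exists>!W'. W' \<in> tuples N \<and> ?step W W'" for W
    unfolding step_iff by (rule linear_periodic_problem[OF P N_ge_1])
  have contr: "tuple_op_norm N Khat (\<lambda>n. U' n - V' n) \<le> q * tuple_op_norm N Khat (\<lambda>n. U n - V n)"
    if "?step U U'" "?step V V'" for U U' V V'
  \<comment> \<open>On subtracting two steps \<open>f n\<close> drops out, and the remaining
    residual is the one bounded by \<open>contraction\<close>.\<close>
  proof (rule iteration_contraction[OF P N_ge_1, where R = "\<lambda>n. Khat (U n - V n) - (K (U n) - K (V n))"])
    fix n assume n: "n \<in> {1..N}"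
    have "P (U' n - U' (cyclic_pred N n)) + Khat (U' n) - (P (V' n - V' (cyclic_pred N n)) + Khat (V' n))
        = f n + Khat (U n) - K (U n) - (f n + Khat (V n) - K (V n))"
      using that n by (simp add: step_iff)
    then show "P (U' n - V' n - (U' (cyclic_pred N n) - V' (cyclic_pred N n))) + Khat (U' n - V' n)
        = Khat (U n - V n) - (K (U n) - K (V n))"
      by (simp add: P.linear_simps linear_simps algebra_simps)
  qed (rule contraction)
  define F where "F W = (THE W'. W' \<in> tuples N \<and> ?step W W')" for W
  have F: "F W \<in> tuples N" "?step W (F W)" for W
    using theI'[OF step[of W]] by (auto simp: F_def)
  have F_eq: "F W = W' \<longleftrightarrow> ?step W W'" if "W' \<in> tuples N" for W W'
    using F[of W] step[of W] that by blast
  \<comment> \<open>This fixed point provides both existence and uniqueness for the nonlinear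
    problem.\<close>
  have "\<exists>!U. U \<in> tuples N \<and> F U = U"
    using F contr q_less_1 by (intro tuples_fixpoint[of F N q]) (auto simp: tuple_dist_def)
  then obtain U where U: "U \<in> tuples N" "F U = U" and unique: "\<And>W. W \<in> tuples N \<Longrightarrow> F W = W \<Longrightarrow> W = U"
    by blast
  have U_step: "?step U U" using F_eq U by blast
  have convergence: "(\<forall>k. tuple_op_norm N Khat (\<lambda>n. Us (Suc k) n - U n)
              \<le> q * tuple_op_norm N Khat (\<lambda>n. Us k n - U n)) \<and>
        (\<lambda>k. tuple_op_norm N Khat (\<lambda>n. Us k n - U n)) \<longlonglongrightarrow> 0"
    if Us: "\<And>k. ?step (Us k) (Us (Suc k))" for Us :: "nat \<Rightarrow> nat \<Rightarrow> 'v"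
  proof -
    define d where "d k = tuple_op_norm N Khat (\<lambda>n. Us k n - U n)" for k
    have d_Suc: "d (Suc k) \<le> q * d k" for k
      unfolding d_def by (rule contr[OF Us U_step])
    have d_nonneg: "d k \<ge> 0" for k
      by (simp add: d_def tuple_op_norm_nonneg)
    \<comment> \<open>Since \<open>q\<close> may be negative, \<open>max q 0\<close> is used: it is
      still below \<open>1\<close>, and multiplication by it is monotone.\<close>
    have d_le: "d k \<le> (max q 0) ^ k * d 0" for k
    proof (induction k)
      case (Suc k)
      have "d (Suc k) \<le> max q 0 * d k"
        using d_Suc[of k] d_nonneg[of k] by (meson max.cobounded1 mult_right_mono order_trans)
      also have "\<dots> \<le> max q 0 * ((max q 0) ^ k * d 0)"
        using Suc by (intro mult_left_mono) auto
      finally show ?case by simp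
    qed simp
    have upper: "(\<lambda>k. (max q 0) ^ k * d 0) \<longlonglongrightarrow> 0"
      using q_less_1 by (intro tendsto_mult_left_zero LIMSEQ_realpow_zero) auto
    have "d \<longlonglongrightarrow> 0"
      by (rule real_tendsto_sandwich[OF _ _ tendsto_const upper]) (simp_all add: d_nonneg d_le)
    then show ?thesis using d_Suc unfolding d_def[abs_def] by blast
  qed
  show ?thesis
  proof (intro bexI[OF _ U(1)] conjI ballI)
    fix W :: "nat \<Rightarrow> 'v" assume "W \<in> tuples N"
    then show "periodic_solution J M K N \<tau> f W \<longleftrightarrow> W = U"
      using F_eq solution_iff unique U_step by blast
  qed (use step convergence in blast)+
qed

end
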